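(* Consider the $M$-group Curie-Weiss model with coupling matrix $J$, where $J$ is either homogeneous or heterogeneous, and assume that the model is in the corresponding high temperature regime. Then $$\left(\frac{S_1}{N_1},\ldots,\frac{S_M}{N_M}\right)\Longrightarrow \delta_0\quad\text{as } N\to\infty,$$ where $\delta_0$ is the Dirac measure at the origin of $\mathbb{R}^M$.
   Context: Setting. Fix $M\in\mathbb{N}$. For each $N$ there are group sizes $N_1,\ldots,N_M\in\mathbb{N}$ with $\sum_\lambda N_\lambda=N$, and as $N\to\infty$ each $N_\lambda\to\infty$ and $N_\lambda/N\to\alpha_\lambda$, where $\alpha_\lambda\ge 0$ (possibly $0$) and $\sum_\lambda\alpha_\lambda=1$. For a fixed positive semi-definite real symmetric $M\times M$ coupling matrix $J=(J_{\lambda\mu})$, the $M$-group Curie-Weiss model is the collection of $\{-1,1\}$-valued random variables $X_{\lambda i}$ ($1\le\lambda\le M$, $1\le i\le N_\lambda$) with $$\mathbb{P}(X_{11}=x_{11},\ldots,X_{MN_M}=x_{MN_M})=Z^{-1}\exp\Big(\frac{1}{2N}\sum_{\lambda,\mu=1}^M J_{\lambda\mu}\sum_{i=1}^{N_\lambda}\sum_{j=1}^{N_\mu}x_{\lambda i}x_{\mu j}\Big),$$ $Z$ being the normalising constant. Put $S_\lambda=\sum_{i=1}^{N_\lambda}X_{\lambda i}$. Classes of coupling matrices. $J$ is homogeneous if all its entries equal one constant $\beta\ge0$; its high temperature regime is $\beta<1$. $J$ is heterogeneous if it is positive definite; with $\boldsymbol\alpha=\mathrm{diag}(\alpha_1,\ldots,\alpha_M)$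 and $H=J^{-1}-\boldsymbol\alpha$, its high temperature regime is the case that $H$ is positive definite. $\Longrightarrow$ denotes weak convergence of the distributions. *)

theory Defs
  imports "HOL-Probability.Probability"
begin

definition pos_semidef :: "real^'m^'m \<Rightarrow> bool" where
  "pos_semidef A \<longleftrightarrow> transpose A = A \<and> (\<forall>v. 0 \<le> v \<bullet> (A *v v))"

definition pos_def :: "real^'m^'m \<Rightarrow> bool" where
  "pos_def A \<longleftrightarrow> transpose A = A \<and> (\<forall>v. v \<noteq> 0 \<longrightarrow> 0 < v \<bullet> (A *v v))"

definition diag_matrix :: "real^'m \<Rightarrow> real^'m^'m" where
  "diag_matrix a = (\<chi> i j. if i = j then a $ i else 0)"

text \<open>Spin configurations for group sizes \<open>n\<close>. They are taken extensional, so that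
  there are exactly \<open>2 ^ (\<Sum>l. n l)\<close> of them.\<close>

definition configs :: "('m \<Rightarrow> nat) \<Rightarrow> ('m \<Rightarrow> nat \<Rightarrow> real) set" where
  "configs n = (\<Pi>\<^sub>E l\<in>UNIV. {1..n l} \<rightarrow>\<^sub>E {-1, 1})"

definition cw_weight :: "real^'m^'m \<Rightarrow> ('m::finite \<Rightarrow> nat) \<Rightarrow> ('m \<Rightarrow> nat \<Rightarrow> real) \<Rightarrow> real" where
  "cw_weight J n x =
     exp (1 / (2 * real (\<Sum>l\<in>UNIV. n l)) *
       (\<Sum>l\<in>UNIV. \<Sum>m\<in>UNIV. J $ l $ m * (\<Sum>i=1..n l. \<Sum>j=1..n m. x l i * x m j)))"

definition cw_Z :: "real^'m^'m \<Rightarrow> ('m::finite \<Rightarrow> nat) \<Rightarrow> real" where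
  "cw_Z J n = (\<Sum>x\<in>configs n. cw_weight J n x)"

locale curie_weiss = prob_space P
  for J :: "real^'m^'m" and n :: "'m::finite \<Rightarrow> nat"
    and P :: "'w measure" and X :: "'m \<Rightarrow> nat \<Rightarrow> 'w \<Rightarrow> real" +
  assumes spin: "i \<in> {1..n l} \<Longrightarrow> X l i \<in> P \<rightarrow>\<^sub>M count_space {-1, 1}"
    and joint_law: "x \<in> configs n \<Longrightarrow>
      prob {w \<in> space P. \<forall>l. \<forall>i\<in>{1..n l}. X l i w = x l i} = cw_weight J n x / cw_Z J n"

definition group_sum :: "('m \<Rightarrow> nat) \<Rightarrow> ('m \<Rightarrow> nat \<Rightarrow> 'w \<Rightarrow> real) \<Rightarrow> 'm \<Rightarrow> 'w \<Rightarrow> real" where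
  "group_sum n X l w = (\<Sum>i=1..n l. X l i w)"

definition homogeneous :: "real \<Rightarrow> real^'m^'m \<Rightarrow> bool" where
  "homogeneous \<beta> J \<longleftrightarrow> 0 \<le> \<beta> \<and> (\<forall>l m. J $ l $ m = \<beta>)"

definition heterogeneous :: "real^'m^'m \<Rightarrow> bool" where
  "heterogeneous J \<longleftrightarrow> pos_def J"

definition high_temperature :: "real^'m \<Rightarrow> real^'m^'m \<Rightarrow> bool" where
  "high_temperature \<alpha> J \<longleftrightarrow>
     (\<exists>\<beta>. homogeneous \<beta> J \<and> \<beta> < 1) \<or>
     (heterogeneous J \<and> pos_def (matrix_inv J - diag_matrix \<alpha>))"

text \<open>Weak convergence of Borel measures against bounded continuous test functions; the
  library's \<^const>\<open>weak_conv_m\<close> is restricted to measures on the real line.\<close>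

definition converges_weakly ::
    "(nat \<Rightarrow> 'a::topological_space measure) \<Rightarrow> 'a measure \<Rightarrow> bool" where
  "converges_weakly \<mu>s \<mu> \<longleftrightarrow>
     (\<forall>f :: 'a \<Rightarrow> real. continuous_on UNIV f \<longrightarrow> bounded (range f) \<longrightarrow>
        (\<lambda>N. \<integral>x. f x \<partial>\<mu>s N) \<longlonglongrightarrow> (\<integral>x. f x \<partial>\<mu>))"

text \<open>The model exists for all group sizes and couplings, so \<^locale>\<open>curie_weiss\<close> is not
  an inconsistent hypothesis.\<close>

lemma finite_configs: "finite (configs (n :: 'm::finite \<Rightarrow> nat))"
  unfolding configs_def by (intro finite_PiE) auto

lemma configs_nonempty: "configs n \<noteq> {}"
  unfolding configs_def by (auto simp: PiE_eq_empty_iff)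

lemma curie_weiss_exists:
  fixes J :: "real^'m^'m" and n :: "'m \<Rightarrow> nat"
  shows "\<exists>(P :: ('m \<Rightarrow> nat \<Rightarrow> real) measure) X. curie_weiss J n P X"
proof -
  define P where "P = point_measure (configs n) (\<lambda>x. ennreal (cw_weight J n x / cw_Z J n))"
  have wpos: "cw_weight J n x > 0" for x
    by (simp add: cw_weight_def)
  have Zpos: "cw_Z J n > 0"
    unfolding cw_Z_def by (intro sum_pos finite_configs configs_nonempty wpos)
  have nonneg: "0 \<le> cw_weight J n x / cw_Z J n" for x
    using wpos[of x] Zpos by simp
  have sp: "space P = configs n" and st: "sets P = Pow (configs n)"
    by (simp_all add: P_def space_point_measure sets_point_measure)
  have em: "emeasure P A = ennreal (\<Sum>x\<in>A. cw_weight J n x / cw_Z J n)" if "A \<subseteq> configs n" for A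
    unfolding P_def using that nonneg
    by (simp add: emeasure_point_measure_finite finite_configs)
  interpret prob_space P
    by standard (use Zpos in \<open>simp add: sp em flip: sum_divide_distrib cw_Z_def\<close>)
  have "curie_weiss J n P (\<lambda>l i x. x l i)"
  proof unfold_locales
    fix i l assume "i \<in> {1..n l}"
    then show "(\<lambda>x. x l i) \<in> P \<rightarrow>\<^sub>M count_space {-1, 1}"
      unfolding P_def measurable_point_measure_eq1
      by (fastforce simp: configs_def PiE_iff)
  next
    fix x assume x: "x \<in> configs n"
    have "{w \<in> space P. \<forall>l. \<forall>i\<in>{1..n l}. w l i = x l i} = {x}"
    proof (intro set_eqI iffI)
      fix w assume w: "w \<in> {w \<in> space P. \<forall>l. \<forall>i\<in>{1..n l}. w l i = x l i}"
      have "w l i = x l i" for l i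
      proof (cases "i \<in> {1..n l}")
        case False
        then have "w l i = undefined" "x l i = undefined"
          using w x by (auto simp: sp configs_def PiE_iff extensional_def)
        then show ?thesis by simp
      qed (use w in blast)
      then show "w \<in> {x}" by auto
    qed (use x sp in auto)
    then show "prob {w \<in> space P. \<forall>l. \<forall>i\<in>{1..n l}. w l i = x l i} = cw_weight J n x / cw_Z J n"
      using x nonneg[of x] by (simp add: measure_def em)
  qed
  then show ?thesis by blast
qed

end

theory Submission
  imports Defs
begin

text \<open>High temperature says that the energy is beaten by the entropy: for large \<open>N\<close> and some \<open>d > 0\<close>,
  the exponent of the Gibbs weight is at most \<open>(1 - d) / 2 \<cdot> (\<Sum>l. S\<^sub>l\<^sup>2 / n\<^sub>l)\<close>. Since \<open>J\<close> is positive
  semi-definite, the partition function is at least the number of configurations. Hence a tail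
  probability under the model is at most the corresponding expectation under independent fair
  spins, which factorises over the groups; each factor is bounded uniformly in \<open>n\<^sub>l\<close>, and giving
  up a part of \<open>d\<close> in a Chernoff bound leaves decay that is exponential in the size of the group
  considered, even if this group has asymptotic proportion \<open>0\<close>.\<close>

section \<open>Exponential moments of sums of fair spins\<close>

text \<open>Hoeffding's lemma for a fair sign: with \<open>p = 1/2\<close> and step
  \<open>2 * s\<close> its auxiliary function is \<open>ln (cosh s)\<close>. Both sides are even in
  \<open>t\<close>, so \<open>s \<ge> 0\<close> suffices.\<close>

lemma cosh_le_exp_half_square:
  fixes t :: real
  shows "cosh t \<le> exp (t\<^sup>2 / 2)"
proof -
  have *: "cosh s \<le> exp (s\<^sup>2 / 2)" if "0 \<le> s" for s :: real
  proof -
    have e: "1 + (1/2) * (exp (2 * s) - 1) = exp s * cosh s"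
      by (simp add: cosh_def algebra_simps flip: exp_add)
    have "- (2 * s) * (1/2) + ln (1 + (1/2) * (exp (2 * s) - 1)) \<le> (2 * s)\<^sup>2 / 8"
      using that by (intro Hoeffdings_lemma_aux) auto
    then have "ln (cosh s) \<le> s\<^sup>2 / 2"
      unfolding e by (simp add: ln_mult power_mult_distrib)
    then have "exp (ln (cosh s)) \<le> exp (s\<^sup>2 / 2)"
      by (subst exp_le_cancel_iff)
    then show ?thesis by (simp add: cosh_real_pos)
  qed
  show ?thesis
    using *[of "\<bar>t\<bar>"] by simp
qed

lemma sum_exp_spins:
  fixes t :: real
  assumes "finite A"
  shows "(\<Sum>y \<in> A \<rightarrow>\<^sub>E {-1, 1}. exp (t * (\<Sum>i\<in>A. y i))) = (2 * cosh t) ^ card A"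
proof -
  have "2 * cosh t = (\<Sum>s\<in>{-1, 1}. exp (t * s))"
    by (simp add: cosh_def)
  then have "(2 * cosh t) ^ card A = (\<Prod>i\<in>A. \<Sum>s\<in>{-1, 1}. exp (t * s))"
    by simp
  also have "\<dots> = (\<Sum>y \<in> A \<rightarrow>\<^sub>E {-1, 1}. \<Prod>i\<in>A. exp (t * y i))"
    using assms by (intro prod_sum_PiE) auto
  also have "\<dots> = (\<Sum>y \<in> A \<rightarrow>\<^sub>E {-1, 1}. exp (t * (\<Sum>i\<in>A. y i)))"
    using assms by (simp add: exp_sum sum_distrib_left)
  finally show ?thesis by simp
qed

text \<open>Completing the square: the exponential tilt shifts the mean of the normal density to
  \<open>a\<close> at the cost of the factor \<open>exp (a\<^sup>2 / 2)\<close>.\<close>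

lemma has_bochner_integral_gaussian_mgf:
  "has_bochner_integral lborel (\<lambda>x. std_normal_density x * exp (a * x)) (exp (a\<^sup>2 / 2))"
proof -
  have "has_bochner_integral lborel (\<lambda>x. exp (a\<^sup>2 / 2) * normal_density a 1 x) (exp (a\<^sup>2 / 2) * 1)"
    by (intro has_bochner_integral_mult_right) (simp add: has_bochner_integral_iff)
  moreover have "exp (a\<^sup>2 / 2) * normal_density a 1 x = std_normal_density x * exp (a * x)" for x
  proof -
    have "a\<^sup>2 / 2 + - (x - a)\<^sup>2 / 2 = - x\<^sup>2 / 2 + a * x"
      by (simp add: power2_eq_square field_simps)
    then have "exp (a\<^sup>2 / 2) * exp (- (x - a)\<^sup>2 / 2) = exp (- x\<^sup>2 / 2) * exp (a * x)"
      by (simp only: exp_add[symmetric])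
    then show ?thesis by (simp add: normal_density_def)
  qed
  ultimately show ?thesis by simp
qed

text \<open>The extra exponential only changes the variance from \<open>1\<close> to
  \<open>1 / (1 - c)\<close>, so the value is the ratio of the normalising constants.\<close>

lemma has_bochner_integral_gaussian_exp_square:
  assumes "c < 1"
  shows "has_bochner_integral lborel (\<lambda>x. std_normal_density x * exp (c * x\<^sup>2 / 2))
           (1 / sqrt (1 - c))"
proof -
  define s where "s = 1 / sqrt (1 - c)"
  have s: "s > 0" "s\<^sup>2 = 1 / (1 - c)"
    using assms by (simp_all add: s_def power_divide)
  have "has_bochner_integral lborel (\<lambda>x. s * normal_density 0 s x) (s * 1)"
    using s by (intro has_bochner_integral_mult_right) (simp add: has_bochner_integral_iff)
  moreover have "s * normal_density 0 s x = std_normal_density x * exp (c * x\<^sup>2 / 2)" for x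
  proof -
    have "- x\<^sup>2 / (2 * s\<^sup>2) = - x\<^sup>2 / 2 + c * x\<^sup>2 / 2"
      using assms by (simp add: s field_simps)
    then have e: "exp (- x\<^sup>2 / (2 * s\<^sup>2)) = exp (- x\<^sup>2 / 2) * exp (c * x\<^sup>2 / 2)"
      by (simp only: exp_add)
    have "s * (1 / sqrt (2 * pi * s\<^sup>2)) = 1 / sqrt (2 * pi)"
      using s(1) by (simp add: real_sqrt_mult)
    then show ?thesis
      by (simp only: normal_density_def diff_zero e mult.assoc[symmetric] power_one mult_1_right)
  qed
  ultimately show ?thesis by (simp add: s_def)
qed

text \<open>Linearising the square with a Gaussian variable makes the bound uniform in the number of
  spins.\<close>

lemma sum_exp_square_spins_le:
  fixes c :: real
  assumes "finite A" "A \<noteq> {}" "0 \<le> c" "c < 1"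
  shows "(\<Sum>y \<in> A \<rightarrow>\<^sub>E {-1, 1}. exp (c / 2 * ((\<Sum>i\<in>A. y i)\<^sup>2 / card A)))
           \<le> 2 ^ card A / sqrt (1 - c)"
proof -
  define k where "k = card A"
  have k: "k > 0" using assms by (simp add: k_def card_gt_0_iff)
  \<comment> \<open>Scaled so that \<open>(b * ?S y)\<^sup>2 / 2\<close> is the wanted exponent; the
    sum over \<open>y\<close> is then the Gaussian expectation of
    \<open>(2 * cosh (b * x)) ^ k\<close>.\<close>
  define b where "b = sqrt (c / k)"
  have b2: "b\<^sup>2 = c / k" using assms by (simp add: b_def)
  let ?S = "\<lambda>y::'a \<Rightarrow> real. \<Sum>i\<in>A. y i"
  let ?Y = "A \<rightarrow>\<^sub>E {-1, 1::real}"
  have "has_bochner_integral lborel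
      (\<lambda>x. \<Sum>y\<in>?Y. std_normal_density x * exp ((b * ?S y) * x)) (\<Sum>y\<in>?Y. exp ((b * ?S y)\<^sup>2 / 2))"
    by (intro has_bochner_integral_sum has_bochner_integral_gaussian_mgf)
  moreover have "(\<Sum>y\<in>?Y. std_normal_density x * exp ((b * ?S y) * x))
      = std_normal_density x * (2 * cosh (b * x)) ^ k" for x
  proof -
    have "(b * ?S y) * x = (b * x) * ?S y" for y by simp
    then show ?thesis
      by (simp only: sum_distrib_left[symmetric] sum_exp_spins[OF assms(1)] k_def)
  qed
  moreover have "(b * ?S y)\<^sup>2 / 2 = c / 2 * ((?S y)\<^sup>2 / k)" for y
    by (simp add: power_mult_distrib b2)
  ultimately have 1: "has_bochner_integral lborel
      (\<lambda>x. std_normal_density x * (2 * cosh (b * x)) ^ k) (\<Sum>y\<in>?Y. exp (c / 2 * ((?S y)\<^sup>2 / k)))"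
    by (simp only:)
  have 2: "has_bochner_integral lborel
      (\<lambda>x. 2 ^ k * (std_normal_density x * exp (c * x\<^sup>2 / 2))) (2 ^ k * (1 / sqrt (1 - c)))"
    using assms by (intro has_bochner_integral_mult_right has_bochner_integral_gaussian_exp_square)
  \<comment> \<open>Since \<open>k * b\<^sup>2 = c\<close>, bounding each \<open>cosh\<close> leaves
    an integrand in which \<open>k\<close> survives only in \<open>2 ^ k\<close>.\<close>
  have "std_normal_density x * (2 * cosh (b * x)) ^ k
      \<le> 2 ^ k * (std_normal_density x * exp (c * x\<^sup>2 / 2))" for x
  proof -
    have "(2 * cosh (b * x)) ^ k \<le> (2 * exp ((b * x)\<^sup>2 / 2)) ^ k"
      by (intro power_mono mult_left_mono cosh_le_exp_half_square) auto
    also have "\<dots> = 2 ^ k * exp (c * x\<^sup>2 / 2)"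
      using k by (simp add: power_mult_distrib b2 flip: exp_of_nat_mult)
    finally have "std_normal_density x * (2 * cosh (b * x)) ^ k
        \<le> std_normal_density x * (2 ^ k * exp (c * x\<^sup>2 / 2))"
      by (intro mult_left_mono) auto
    then show "std_normal_density x * (2 * cosh (b * x)) ^ k
        \<le> 2 ^ k * (std_normal_density x * exp (c * x\<^sup>2 / 2))"
      by (simp add: mult_ac)
  qed
  then have "(\<Sum>y\<in>?Y. exp (c / 2 * ((?S y)\<^sup>2 / k))) \<le> 2 ^ k * (1 / sqrt (1 - c))"
    unfolding has_bochner_integral_integral_eq[OF 1, symmetric]
      has_bochner_integral_integral_eq[OF 2, symmetric]
    by (intro integral_mono integrable.intros[OF 1] integrable.intros[OF 2])
  then show ?thesis by (simp add: k_def)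
qed

section \<open>Gibbs weights and the tail bound for the group means\<close>

definition spin_sums :: "('m \<Rightarrow> nat) \<Rightarrow> ('m \<Rightarrow> nat \<Rightarrow> real) \<Rightarrow> real^'m" where
  "spin_sums n x = (\<chi> l. \<Sum>i=1..n l. x l i)"

text \<open>The double spin sum of two groups is the product of their totals, so the weight depends
  on the configuration only through the group sums.\<close>

lemma cw_weight_eq:
  "cw_weight J n x =
     exp (spin_sums n x \<bullet> (J *v spin_sums n x) / (2 * real (\<Sum>l\<in>UNIV. n l)))"
proof -
  have "spin_sums n x \<bullet> (J *v spin_sums n x)
      = (\<Sum>l\<in>UNIV. \<Sum>m\<in>UNIV. J $ l $ m * (\<Sum>i=1..n l. \<Sum>j=1..n m. x l i * x m j))"
    unfolding inner_vec_def matrix_vector_mult_def sum_product[symmetric]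
    by (simp add: spin_sums_def sum_distrib_left mult_ac)
  then show ?thesis by (simp add: cw_weight_def)
qed

lemma card_configs: "card (configs n) = 2 ^ (\<Sum>l\<in>UNIV. n (l :: 'm::finite))"
  by (simp add: configs_def card_PiE power_sum numeral_2_eq_2)

lemma cw_Z_ge:
  assumes "pos_semidef J"
  shows "2 ^ (\<Sum>l\<in>UNIV. n l) \<le> cw_Z J n"
proof -
  have "(\<Sum>x\<in>configs n. 1) \<le> (\<Sum>x\<in>configs n. cw_weight J n x)"
    using assms by (intro sum_mono) (simp add: cw_weight_eq pos_semidef_def sum_nonneg)
  then show ?thesis
    by (simp add: card_configs cw_Z_def)
qed

text \<open>Both the set of configurations and the exponential are products over the groups, so the
  single-group bound applies factor by factor; \<open>0 < n l\<close> makes the index sets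
  nonempty.\<close>

lemma sum_configs_exp_le:
  fixes n :: "'m::finite \<Rightarrow> nat"
  assumes "\<And>l. 0 < n l" "0 \<le> c" "c < 1"
  shows "(\<Sum>x\<in>configs n. exp (c / 2 * (\<Sum>l\<in>UNIV. (spin_sums n x $ l)\<^sup>2 / n l)))
           \<le> 2 ^ (\<Sum>l\<in>UNIV. n l) / sqrt (1 - c) ^ CARD('m)"
proof -
  have "(\<Sum>x\<in>configs n. exp (c / 2 * (\<Sum>l\<in>UNIV. (spin_sums n x $ l)\<^sup>2 / n l)))
      = (\<Sum>x\<in>configs n. \<Prod>l\<in>UNIV. exp (c / 2 * ((\<Sum>i=1..n l. x l i)\<^sup>2 / n l)))"
    by (simp add: spin_sums_def exp_sum sum_distrib_left)
  also have "\<dots> = (\<Prod>l\<in>UNIV. \<Sum>y \<in> {1..n l} \<rightarrow>\<^sub>E {-1, 1}. exp (c / 2 * ((\<Sum>i=1..n l. y i)\<^sup>2 / n l)))"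
    unfolding configs_def by (intro prod_sum_PiE[symmetric]) (auto intro: finite_PiE)
  also have "\<dots> \<le> (\<Prod>l\<in>UNIV. 2 ^ n l / sqrt (1 - c))"
  proof (intro prod_mono conjI sum_nonneg)
    fix l :: 'm
    show "(\<Sum>y \<in> {1..n l} \<rightarrow>\<^sub>E {-1, 1}. exp (c / 2 * ((\<Sum>i=1..n l. y i)\<^sup>2 / n l)))
        \<le> 2 ^ n l / sqrt (1 - c)"
      using sum_exp_square_spins_le[of "{1..n l}" c] assms(1)[of l] assms(2,3)
      by (simp add: Suc_le_eq)
  qed auto
  also have "\<dots> = 2 ^ (\<Sum>l\<in>UNIV. n l) / sqrt (1 - c) ^ CARD('m)"
    by (simp add: prod_dividef power_sum)
  finally show ?thesis .
qed

text \<open>An event of the spins is covered by the elementary events whose probabilities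
  \<open>joint_law\<close> prescribes; subadditivity adds these up.\<close>

lemma (in curie_weiss) config_event_le:
  "prob {w \<in> space P. Q (\<lambda>l. \<lambda>i\<in>{1..n l}. X l i w)}
     \<le> (\<Sum>x | x \<in> configs n \<and> Q x. cw_weight J n x) / cw_Z J n"
proof -
  define E where "E x = {w \<in> space P. \<forall>l. \<forall>i\<in>{1..n l}. X l i w = x l i}" for x
  have [measurable]: "(\<lambda>w. X l i w) \<in> borel_measurable P" if "i \<in> {1..n l}" for l i
    using spin[OF that] by (rule measurable_compose) (simp add: measurable_count_space_eq1)
  have meas: "E x \<in> events" for x
    unfolding E_def by measurable
  \<comment> \<open>Restriction to \<open>{1..n l}\<close> makes the observed values extensional, as
    membership in \<open>configs n\<close> demands.\<close>
  have conf: "(\<lambda>l. \<lambda>i\<in>{1..n l}. X l i w) \<in> configs n" if "w \<in> space P" for w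
    unfolding configs_def
    using measurable_space[OF spin that] by (intro PiE_I) auto
  have "{w \<in> space P. Q (\<lambda>l. \<lambda>i\<in>{1..n l}. X l i w)} \<subseteq> (\<Union>x\<in>{x \<in> configs n. Q x}. E x)"
  proof
    fix w assume w: "w \<in> {w \<in> space P. Q (\<lambda>l. \<lambda>i\<in>{1..n l}. X l i w)}"
    then have "w \<in> E (\<lambda>l. \<lambda>i\<in>{1..n l}. X l i w)" by (simp add: E_def)
    with w conf show "w \<in> (\<Union>x\<in>{x \<in> configs n. Q x}. E x)" by blast
  qed
  then have "prob {w \<in> space P. Q (\<lambda>l. \<lambda>i\<in>{1..n l}. X l i w)}
      \<le> prob (\<Union>x\<in>{x \<in> configs n. Q x}. E x)"
    using meas finite_configs[of n] by (intro finite_measure_mono) auto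
  also have "\<dots> \<le> (\<Sum>x | x \<in> configs n \<and> Q x. prob (E x))"
    using meas finite_configs[of n] by (intro finite_measure_subadditive_finite) auto
  also have "\<dots> = (\<Sum>x | x \<in> configs n \<and> Q x. cw_weight J n x / cw_Z J n)"
    unfolding E_def by (intro sum.cong refl joint_law) auto
  finally show ?thesis by (simp add: sum_divide_distrib)
qed

text \<open>Chernoff's argument: on the tail event the \<open>k\<close>-th term of the weighted sum
  of squares is at least \<open>e\<^sup>2 * n k\<close>, so part of the gap \<open>d\<close> yields
  the decaying factor, and the rest is bounded by the sum for fair spins.\<close>

lemma (in curie_weiss) group_mean_tail:
  assumes psd: "pos_semidef J" and pos: "\<And>l. 0 < n l"
    and d: "0 < d" "d \<le> 1" and e: "0 < e"
    and form: "\<And>v. v \<bullet> (J *v v) / real (\<Sum>l\<in>UNIV. n l) \<le> (1 - d) * (\<Sum>l\<in>UNIV. (v $ l)\<^sup>2 / n l)"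
  shows "prob {w \<in> space P. e \<le> \<bar>group_sum n X k w / n k\<bar>}
           \<le> exp (- (d * e\<^sup>2 / 4 * n k)) / sqrt (d / 2) ^ CARD('m)"
proof -
  define T where "T v = (\<Sum>l\<in>UNIV. (v $ l)\<^sup>2 / real (n l))" for v :: "real^'m"
  define Q where "Q x \<longleftrightarrow> e \<le> \<bar>spin_sums n x $ k / n k\<bar>" for x
  define C where "C = exp (- (d * e\<^sup>2 / 4 * n k))"
  \<comment> \<open>Half of the gap \<open>d\<close> is spent on the decay; the other half keeps
    \<open>?c\<close> below \<open>1\<close>, as \<open>sum_configs_exp_le\<close> requires.\<close>
  let ?c = "1 - d / 2"
  have bound: "cw_weight J n x \<le> C * exp (?c / 2 * T (spin_sums n x))" if "Q x" for x
  proof -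
    define v where "v = spin_sums n x"
    have "e\<^sup>2 \<le> (v $ k / n k)\<^sup>2"
      using that e by (intro power2_le_iff_abs_le[THEN iffD2] abs_le_square_iff[THEN iffD1])
        (auto simp: Q_def v_def)
    then have "e\<^sup>2 * n k \<le> (v $ k)\<^sup>2 / n k"
      using pos[of k] by (simp add: field_simps power2_eq_square)
    also have "\<dots> \<le> T v"
      unfolding T_def by (rule member_le_sum) auto
    finally have "d / 4 * (e\<^sup>2 * n k) \<le> d / 4 * T v"
      using d by (intro mult_left_mono) auto
    moreover have "v \<bullet> (J *v v) / (2 * real (\<Sum>l\<in>UNIV. n l)) \<le> (1 - d) / 2 * T v"
      using form[of v] by (simp add: T_def)
    ultimately have "v \<bullet> (J *v v) / (2 * real (\<Sum>l\<in>UNIV. n l))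
        \<le> - (d * e\<^sup>2 / 4 * n k) + ?c / 2 * T v"
      by (simp add: algebra_simps add_divide_distrib diff_divide_distrib)
    then show ?thesis
      by (simp add: cw_weight_eq C_def v_def flip: exp_add)
  qed
  have "prob {w \<in> space P. e \<le> \<bar>group_sum n X k w / n k\<bar>}
      \<le> (\<Sum>x | x \<in> configs n \<and> Q x. cw_weight J n x) / cw_Z J n"
    using config_event_le[of Q] by (simp add: Q_def spin_sums_def group_sum_def)
  \<comment> \<open>The number of configurations in the numerator will cancel against the lower
    bound on \<open>cw_Z\<close>, and \<open>1 - ?c = d / 2\<close>.\<close>
  also have "\<dots> \<le> (C * (2 ^ (\<Sum>l\<in>UNIV. n l) / sqrt (1 - ?c) ^ CARD('m))) / 2 ^ (\<Sum>l\<in>UNIV. n l)"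
  proof (intro frac_le)
    have "(\<Sum>x | x \<in> configs n \<and> Q x. cw_weight J n x)
        \<le> (\<Sum>x | x \<in> configs n \<and> Q x. C * exp (?c / 2 * T (spin_sums n x)))"
      using bound by (intro sum_mono) auto
    also have "\<dots> \<le> (\<Sum>x\<in>configs n. C * exp (?c / 2 * T (spin_sums n x)))"
      by (intro sum_mono2 finite_configs) (auto simp: C_def)
    also have "\<dots> \<le> C * (2 ^ (\<Sum>l\<in>UNIV. n l) / sqrt (1 - ?c) ^ CARD('m))"
      unfolding T_def sum_distrib_left[symmetric, of C] using pos d
      by (intro mult_left_mono sum_configs_exp_le) (auto simp: C_def)
    finally show "(\<Sum>x | x \<in> configs n \<and> Q x. cw_weight J n x)
        \<le> C * (2 ^ (\<Sum>l\<in>UNIV. n l) / sqrt (1 - ?c) ^ CARD('m))" .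
    show "2 ^ (\<Sum>l\<in>UNIV. n l) \<le> cw_Z J n"
      by (rule cw_Z_ge[OF psd])
  qed (use d in \<open>auto simp: C_def\<close>)
  finally show ?thesis by (simp add: C_def)
qed

section \<open>Bounds on the quadratic form in the high temperature regimes\<close>

text \<open>Cauchy-Schwarz for \<open>v i / sqrt (a i)\<close> and \<open>sqrt (a i) * u i\<close>.
  The weights will be the group proportions.\<close>

lemma weighted_Cauchy_Schwarz_ineq_sum:
  fixes a u v :: "'a \<Rightarrow> real"
  assumes "\<And>i. i \<in> A \<Longrightarrow> 0 < a i"
  shows "(\<Sum>i\<in>A. v i * u i)\<^sup>2 \<le> (\<Sum>i\<in>A. (v i)\<^sup>2 / a i) * (\<Sum>i\<in>A. a i * (u i)\<^sup>2)"
proof -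
  have "(\<Sum>i\<in>A. (v i / sqrt (a i)) * (sqrt (a i) * u i))\<^sup>2
      \<le> (\<Sum>i\<in>A. (v i / sqrt (a i))\<^sup>2) * (\<Sum>i\<in>A. (sqrt (a i) * u i)\<^sup>2)"
    by (rule Cauchy_Schwarz_ineq_sum)
  also have "(\<Sum>i\<in>A. (v i / sqrt (a i)) * (sqrt (a i) * u i)) = (\<Sum>i\<in>A. v i * u i)"
    by (intro sum.cong) (use assms in force)+
  also have "(\<Sum>i\<in>A. (v i / sqrt (a i))\<^sup>2) = (\<Sum>i\<in>A. (v i)\<^sup>2 / a i)"
    using assms by (intro sum.cong) (auto simp: power_divide less_imp_le)
  also have "(\<Sum>i\<in>A. (sqrt (a i) * u i)\<^sup>2) = (\<Sum>i\<in>A. a i * (u i)\<^sup>2)"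
    using assms by (intro sum.cong) (auto simp: power_mult_distrib less_imp_le)
  finally show ?thesis .
qed

text \<open>The form is \<open>\<beta>\<close> times the square of the coordinate sum, which
  weighted Cauchy-Schwarz with \<open>u = 1\<close> bounds because the weights sum to
  \<open>1\<close>.\<close>

lemma homogeneous_form_le:
  fixes J :: "real^'m^'m"
  assumes J: "homogeneous \<beta> J" and a: "\<And>l. 0 < a l" "(\<Sum>l\<in>UNIV. a l) = 1"
  shows "v \<bullet> (J *v v) \<le> \<beta> * (\<Sum>l\<in>UNIV. (v $ l)\<^sup>2 / a l)"
proof -
  have "v \<bullet> (J *v v) = \<beta> * (\<Sum>l\<in>UNIV. v $ l)\<^sup>2"
    using J by (simp add: homogeneous_def inner_vec_def matrix_vector_mult_def power2_eq_square
        sum_distrib_right mult_ac flip: sum_distrib_left)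
  also have "\<dots> \<le> \<beta> * (\<Sum>l\<in>UNIV. (v $ l)\<^sup>2 / a l)"
    using J weighted_Cauchy_Schwarz_ineq_sum[of UNIV a "\<lambda>l. v $ l" "\<lambda>_. 1"] a
    by (intro mult_left_mono) (auto simp: homogeneous_def)
  finally show ?thesis .
qed

text \<open>The form attains its minimum on the compact unit sphere, where it is positive; scaling
  carries the bound to all vectors.\<close>

lemma pos_def_lower_bound:
  fixes A :: "real^'m^'m"
  assumes "pos_def A"
  obtains h where "0 < h" "\<And>v. h * (norm v)\<^sup>2 \<le> v \<bullet> (A *v v)"
proof -
  have "continuous_on (sphere 0 1) (\<lambda>v. v \<bullet> (A *v v))"
    by (intro continuous_intros linear_continuous_on matrix_vector_mul_bounded_linear)
  moreover have "(sphere 0 1 :: (real^'m) set) \<noteq> {}" by simp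
  ultimately obtain z where z: "z \<in> sphere 0 1"
    and min: "\<And>v. v \<in> sphere 0 1 \<Longrightarrow> z \<bullet> (A *v z) \<le> v \<bullet> (A *v v)"
    using continuous_attains_inf[of "sphere 0 1 :: (real^'m) set" "\<lambda>v. v \<bullet> (A *v v)"] by auto
  show ?thesis
  proof
    have "z \<noteq> 0" using z by auto
    with assms show "0 < z \<bullet> (A *v z)" by (simp add: pos_def_def)
    fix v :: "real^'m"
    show "(z \<bullet> (A *v z)) * (norm v)\<^sup>2 \<le> v \<bullet> (A *v v)"
    proof (cases "v = 0")
      case False
      define u where "u = (1 / norm v) *\<^sub>R v"
      have "v = norm v *\<^sub>R u" using False by (simp add: u_def)
      then have "v \<bullet> (A *v v) = (norm v)\<^sup>2 * (u \<bullet> (A *v u))"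
        by (metis inner_scaleR_left inner_scaleR_right matrix_vector_mult_scaleR mult.assoc
            power2_eq_square)
      moreover have "u \<in> sphere 0 1" using False by (simp add: u_def)
      ultimately show ?thesis
        using min[of u] by (simp add: mult.commute mult_right_mono)
    qed simp
  qed
qed

text \<open>A vector in the kernel has form value \<open>0\<close>, so positive definiteness makes
  \<open>J\<close> injective, hence invertible.\<close>

lemma pos_def_matrix_inv:
  fixes J :: "real^'m^'m"
  assumes "pos_def J"
  shows "matrix_inv J *v (J *v v) = v"
proof -
  have "inj ((*v) J)"
    unfolding linear_injective_0[OF matrix_vector_mul_linear]
    using assms by (metis inner_zero_right less_irrefl pos_def_def)
  then have "invertible J"
    using invertible_left_inverse matrix_left_invertible_injective by blast
  \<comment> \<open>\<open>matrix_inv\<close> is a choice, so the existence just shown is what makes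
    it an inverse.\<close>
  then have "matrix_inv J ** J = mat 1"
    unfolding matrix_inv_def invertible_def by (metis (mono_tags, lifting) someI_ex)
  then show ?thesis
    by (simp add: matrix_vector_mul_assoc)
qed

text \<open>For \<open>u = J v\<close> the form of \<open>J\<close> at \<open>v\<close> equals both \<open>v \<bullet> u\<close> and the form of the inverse of \<open>J\<close>
  at \<open>u\<close>, so a bound by that inverse turns the Cauchy-Schwarz inequality into a bound on \<open>J\<close>.\<close>

lemma heterogeneous_form_le:
  fixes J :: "real^'m^'m"
  assumes J: "pos_def J" and a: "\<And>l. 0 < a l"
    and le: "\<And>u. (\<Sum>l\<in>UNIV. a l * (u $ l)\<^sup>2) \<le> c * (u \<bullet> (matrix_inv J *v u))"
  shows "v \<bullet> (J *v v) \<le> c * (\<Sum>l\<in>UNIV. (v $ l)\<^sup>2 / a l)"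
proof (cases "v = 0")
  case False
  define q where "q = v \<bullet> (J *v v)"
  \<comment> \<open>Positivity lets one factor \<open>q\<close> be cancelled from the final estimate
    of \<open>q\<^sup>2\<close>.\<close>
  have q: "0 < q" using False J by (simp add: pos_def_def q_def)
  have "q\<^sup>2 \<le> (\<Sum>l\<in>UNIV. (v $ l)\<^sup>2 / a l) * (\<Sum>l\<in>UNIV. a l * ((J *v v) $ l)\<^sup>2)"
    using weighted_Cauchy_Schwarz_ineq_sum[of UNIV a "\<lambda>l. v $ l" "\<lambda>l. (J *v v) $ l"] a
    by (simp add: q_def inner_vec_def)
  also have "\<dots> \<le> (\<Sum>l\<in>UNIV. (v $ l)\<^sup>2 / a l) * (c * ((J *v v) \<bullet> (matrix_inv J *v (J *v v))))"
    using a by (intro mult_left_mono le sum_nonneg) (auto simp: less_imp_le)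
  also have "\<dots> = c * (\<Sum>l\<in>UNIV. (v $ l)\<^sup>2 / a l) * q"
    by (simp add: pos_def_matrix_inv[OF J] q_def inner_commute mult_ac)
  finally show ?thesis
    using q by (simp add: power2_eq_square flip: q_def)
qed simp

lemma diag_matrix_form: "v \<bullet> (diag_matrix a *v v) = (\<Sum>l\<in>UNIV. a $ l * (v $ l)\<^sup>2)"
  by (simp add: diag_matrix_def inner_vec_def matrix_vector_mult_def power2_eq_square
      if_distrib[of "\<lambda>x. x * _"] cong: if_cong) (simp add: mult_ac)

text \<open>The margin \<open>h\<close> of the positive definite difference is halved: one half
  absorbs the deviation of \<open>a N\<close> from \<open>\<alpha>\<close>, the other becomes the
  relative gap \<open>d\<close>, since the form of \<open>K\<close> is at most a multiple of the
  squared norm.\<close>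

lemma eventually_diagonal_le:
  fixes K :: "real^'m^'m"
  assumes H: "pos_def (K - diag_matrix \<alpha>)"
    and lim: "\<And>l. ((\<lambda>N. a N l) \<longlongrightarrow> \<alpha> $ l) F"
  obtains d where "0 < d" "d \<le> 1"
    "\<forall>\<^sub>F N in F. \<forall>u. (\<Sum>l\<in>UNIV. a N l * (u $ l)\<^sup>2) \<le> (1 - d) * (u \<bullet> (K *v u))"
proof -
  obtain h where h: "0 < h"
    and hle: "\<And>u. h * (norm u)\<^sup>2 \<le> u \<bullet> ((K - diag_matrix \<alpha>) *v u)"
    using pos_def_lower_bound[OF H] by blast
  have split: "u \<bullet> ((K - diag_matrix \<alpha>) *v u) = u \<bullet> (K *v u) - (\<Sum>l\<in>UNIV. \<alpha> $ l * (u $ l)\<^sup>2)" for u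
    by (simp add: matrix_vector_mult_diff_rdistrib inner_diff_right diag_matrix_form)
  obtain B where B: "0 < B" "\<And>u. norm (K *v u) \<le> norm u * B"
    using bounded_linear.pos_bounded[OF matrix_vector_mul_bounded_linear] by blast
  \<comment> \<open>Chosen so that \<open>d * B \<le> h / 2\<close>; the cap \<open>1\<close> keeps
    \<open>1 - d\<close> nonnegative.\<close>
  define d where "d = min 1 (h / (2 * B))"
  have d: "0 < d" "d \<le> 1" "d * B \<le> h / 2"
    using h B(1) by (auto simp: d_def min_def field_simps)
  have "\<forall>\<^sub>F N in F. \<forall>l. a N l < \<alpha> $ l + h / 2"
    using h by (intro eventually_all_finite order_tendstoD(2)[OF lim]) auto
  then have "\<forall>\<^sub>F N in F. \<forall>u. (\<Sum>l\<in>UNIV. a N l * (u $ l)\<^sup>2) \<le> (1 - d) * (u \<bullet> (K *v u))"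
  proof eventually_elim
    case (elim N)
    show ?case
    proof
      fix u :: "real^'m"
      have norm2: "(norm u)\<^sup>2 = (\<Sum>l\<in>UNIV. (u $ l)\<^sup>2)"
        by (simp add: power2_norm_eq_inner inner_vec_def flip: power2_eq_square)
      have "(\<Sum>l\<in>UNIV. a N l * (u $ l)\<^sup>2) \<le> (\<Sum>l\<in>UNIV. (\<alpha> $ l + h / 2) * (u $ l)\<^sup>2)"
        using elim by (intro sum_mono mult_right_mono) (auto simp: less_imp_le)
      also have "\<dots> = (\<Sum>l\<in>UNIV. \<alpha> $ l * (u $ l)\<^sup>2) + h / 2 * (norm u)\<^sup>2"
        by (simp add: norm2 algebra_simps sum.distrib sum_distrib_left)
      also have "\<dots> \<le> u \<bullet> (K *v u) - h / 2 * (norm u)\<^sup>2"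
        using hle[of u] by (simp add: split)
      also have "\<dots> \<le> (1 - d) * (u \<bullet> (K *v u))"
      proof -
        have "u \<bullet> (K *v u) \<le> norm u * (norm u * B)"
          using B(2)[of u] by (intro order_trans[OF norm_cauchy_schwarz] mult_left_mono) auto
        then have "d * (u \<bullet> (K *v u)) \<le> d * (norm u * (norm u * B))"
          using d by (intro mult_left_mono) auto
        also have "\<dots> = d * B * (norm u)\<^sup>2"
          by (simp add: power2_eq_square)
        also have "\<dots> \<le> h / 2 * (norm u)\<^sup>2"
          using d(3) by (intro mult_right_mono) auto
        finally show ?thesis by (simp add: algebra_simps)
      qed
      finally show "(\<Sum>l\<in>UNIV. a N l * (u $ l)\<^sup>2) \<le> (1 - d) * (u \<bullet> (K *v u))" .
    qed
  qed
  with d that show ?thesis by blast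
qed

text \<open>Brings both regimes to the one shape that the tail bound takes: the gap \<open>d\<close>
  is \<open>1 - \<beta>\<close> in the homogeneous case and stems from the positive definite
  \<open>matrix_inv J - diag_matrix \<alpha>\<close> in the heterogeneous one.\<close>

lemma high_temperature_form_le:
  fixes J :: "real^'m^'m"
  assumes ht: "high_temperature \<alpha> J"
    and lim: "\<And>l. ((\<lambda>N. a N l) \<longlongrightarrow> \<alpha> $ l) F"
    and pos: "\<forall>\<^sub>F N in F. \<forall>l. 0 < a N l" and sum1: "\<forall>\<^sub>F N in F. (\<Sum>l\<in>UNIV. a N l) = 1"
  obtains d where "0 < d" "d \<le> 1"
    "\<forall>\<^sub>F N in F. \<forall>v. v \<bullet> (J *v v) \<le> (1 - d) * (\<Sum>l\<in>UNIV. (v $ l)\<^sup>2 / a N l)"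
  using ht unfolding high_temperature_def
proof (elim disjE exE conjE)
  fix \<beta> assume \<beta>: "homogeneous \<beta> J" "\<beta> < 1"
  from pos sum1
  have "\<forall>\<^sub>F N in F. \<forall>v. v \<bullet> (J *v v) \<le> (1 - (1 - \<beta>)) * (\<Sum>l\<in>UNIV. (v $ l)\<^sup>2 / a N l)"
    by eventually_elim (use homogeneous_form_le[OF \<beta>(1)] in auto)
  then show thesis
    by (rule that[rotated 2]) (use \<beta> in \<open>auto simp: homogeneous_def\<close>)
next
  assume J: "heterogeneous J" and H: "pos_def (matrix_inv J - diag_matrix \<alpha>)"
  obtain d where d: "0 < d" "d \<le> 1"
    and le: "\<forall>\<^sub>F N in F. \<forall>u. (\<Sum>l\<in>UNIV. a N l * (u $ l)\<^sup>2) \<le> (1 - d) * (u \<bullet> (matrix_inv J *v u))"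
    using eventually_diagonal_le[OF H lim] by blast
  from pos le
  have "\<forall>\<^sub>F N in F. \<forall>v. v \<bullet> (J *v v) \<le> (1 - d) * (\<Sum>l\<in>UNIV. (v $ l)\<^sup>2 / a N l)"
    by eventually_elim
      (use heterogeneous_form_le J[unfolded heterogeneous_def] in blast)
  with d show thesis by (rule that)
qed

section \<open>From tail bounds to weak convergence\<close>

text \<open>Convergence in probability to a constant implies weak convergence to its point mass:
  near \<open>c\<close> continuity controls the test function, elsewhere its oscillation
  \<open>2 * B\<close> meets a vanishing probability.\<close>

lemma converges_weakly_return:
  fixes Y :: "nat \<Rightarrow> 'w \<Rightarrow> real^'m"
  assumes prob: "\<And>N. prob_space (P N)" and meas: "\<And>N. Y N \<in> borel_measurable (P N)"
    and tail: "\<And>e l. 0 < e \<Longrightarrow> (\<lambda>N. measure (P N) {w \<in> space (P N). e \<le> \<bar>Y N w $ l - c $ l\<bar>}) \<longlonglongrightarrow> 0"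
  shows "converges_weakly (\<lambda>N. distr (P N) borel (Y N)) (return borel c)"
  unfolding converges_weakly_def
proof (intro allI impI)
  fix f :: "real^'m \<Rightarrow> real"
  assume f: "continuous_on UNIV f" "bounded (range f)"
  obtain B where B: "0 < B" "\<And>x. \<bar>f x\<bar> \<le> B"
    using f(2) by (auto simp: bounded_pos)
  have fm [measurable]: "f \<in> borel_measurable borel"
    using f(1) by (rule borel_measurable_continuous_onI)
  have lim: "(\<integral>x. f x \<partial>return borel c) = f c"
    by (rule integral_return) (auto simp: fm)
  have "(\<lambda>N. (\<integral>x. f x \<partial>distr (P N) borel (Y N))) \<longlonglongrightarrow> f c"
  proof (rule tendstoI)
    fix r :: real assume r: "0 < r"
    obtain s where s: "0 < s" "\<And>x. dist x c < s \<Longrightarrow> dist (f x) (f c) < r / 2"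
      using f(1) r unfolding continuous_on_iff by (metis UNIV_I half_gt_zero)
    \<comment> \<open>If every coordinate is within \<open>e\<close> of that of \<open>c\<close>,
      then the l1 distance, hence the Euclidean one, is below \<open>s\<close>.\<close>
    define e where "e = s / CARD('m)"
    have e: "0 < e" using s by (simp add: e_def)
    define p where "p N l = measure (P N) {w \<in> space (P N). e \<le> \<bar>Y N w $ l - c $ l\<bar>}" for N l
    have "(\<lambda>N. 2 * B * (\<Sum>l\<in>UNIV. p N l)) \<longlonglongrightarrow> 2 * B * (\<Sum>l\<in>(UNIV::'m set). 0)"
      unfolding p_def by (intro tendsto_intros tail e)
    then have "\<forall>\<^sub>F N in sequentially. 2 * B * (\<Sum>l\<in>UNIV. p N l) < r / 2"
      using r by (intro order_tendstoD) auto
    then show "\<forall>\<^sub>F N in sequentially. dist (\<integral>x. f x \<partial>distr (P N) borel (Y N)) (f c) < r"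
    proof eventually_elim
      case (elim N)
      interpret prob_space "P N" by (rule prob)
      note meas[of N, measurable]
      define A where "A l = {w \<in> space (P N). e \<le> \<bar>Y N w $ l - c $ l\<bar>}" for l
      have A [measurable]: "A l \<in> events" for l
      proof -
        have "(\<lambda>w. Y N w $ l) \<in> borel_measurable (P N)"
          by (rule borel_measurable_continuous_onI[THEN measurable_compose[OF meas]])
            (intro continuous_intros)
        then show ?thesis unfolding A_def by measurable
      qed
      have int: "integrable (P N) (\<lambda>w. f (Y N w))"
        by (rule integrable_const_bound[of _ B]) (use B in auto)
      \<comment> \<open>The sum of indicators dominates the indicator of the union of the
        \<open>A l\<close>; taking expectations turns it into the sum of the
        \<open>p N l\<close>.\<close>
      have pt: "\<bar>f (Y N w) - f c\<bar> \<le> r / 2 + 2 * B * (\<Sum>l\<in>UNIV. indicator (A l) w)"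
        if w: "w \<in> space (P N)" for w
      proof (cases "\<exists>l. w \<in> A l")
        case True
        then obtain l where "w \<in> A l" by blast
        then have "(1::real) \<le> indicator (A l) w" by simp
        also have "\<dots> \<le> (\<Sum>l\<in>UNIV. indicator (A l) w)"
          by (rule member_le_sum) auto
        finally have "2 * B * 1 \<le> 2 * B * (\<Sum>l\<in>UNIV. indicator (A l) w)"
          using B by (intro mult_left_mono) auto
        then show ?thesis
          using B(2)[of "Y N w"] B(2)[of c] r by linarith
      next
        case False
        have "dist (Y N w) c \<le> (\<Sum>l\<in>UNIV. \<bar>Y N w $ l - c $ l\<bar>)"
          using norm_le_l1_cart[of "Y N w - c"] by (simp add: dist_norm)
        also have "\<dots> < (\<Sum>l\<in>(UNIV::'m set). e)"
          using False w by (intro sum_strict_mono) (auto simp: A_def not_le)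
        also have "\<dots> = s" by (simp add: e_def)
        finally have "\<bar>f (Y N w) - f c\<bar> < r / 2"
          using s(2) by (simp add: dist_real_def)
        moreover have "0 \<le> 2 * B * (\<Sum>l\<in>UNIV. indicator (A l) w)"
          using B by (intro mult_nonneg_nonneg sum_nonneg) auto
        ultimately show ?thesis by linarith
      qed
      have int1 [simp]: "integrable (P N) (indicat_real (A l))" for l
        by (rule integrable_const_bound[of _ 1]) auto
      have int2: "integrable (P N) (\<lambda>w. r / 2 + 2 * B * (\<Sum>l\<in>UNIV. indicator (A l) w))"
        by (intro Bochner_Integration.integrable_add integrable_mult_right
            Bochner_Integration.integrable_sum int1 integrable_const)
      have "\<bar>expectation (\<lambda>w. f (Y N w)) - f c\<bar> = \<bar>expectation (\<lambda>w. f (Y N w) - f c)\<bar>"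
        using int by (simp add: prob_space)
      also have "\<dots> \<le> expectation (\<lambda>w. \<bar>f (Y N w) - f c\<bar>)"
        by (rule integral_abs_bound)
      also have "\<dots> \<le> expectation (\<lambda>w. r / 2 + 2 * B * (\<Sum>l\<in>UNIV. indicator (A l) w))"
        using int pt by (intro integral_mono int2) auto
      also have "\<dots> = r / 2 + 2 * B * (\<Sum>l\<in>UNIV. p N l)"
        using int1 by (simp add: prob_space p_def flip: A_def)
      finally show ?case
        using elim by (simp add: integral_distr dist_real_def)
    qed
  qed
  then show "(\<lambda>N. (\<integral>x. f x \<partial>distr (P N) borel (Y N))) \<longlonglongrightarrow> (\<integral>x. f x \<partial>return borel c)"
    by (simp add: lim)
qed

theorem theorem9:
  fixes J :: "real^'m^'m"
    and \<alpha> :: "real^'m"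
    and n :: "nat \<Rightarrow> 'm \<Rightarrow> nat"
    and P :: "nat \<Rightarrow> 'w measure"
    and X :: "nat \<Rightarrow> 'm \<Rightarrow> nat \<Rightarrow> 'w \<Rightarrow> real"
  assumes sizes_sum: "\<And>N. (\<Sum>l\<in>UNIV. n N l) = N"
    and sizes_at_top: "\<And>l. filterlim (\<lambda>N. n N l) at_top sequentially"
    and proportions: "\<And>l. (\<lambda>N. real (n N l) / real N) \<longlonglongrightarrow> \<alpha> $ l"
    and alpha_nonneg: "\<And>l. 0 \<le> \<alpha> $ l"
    and alpha_sum: "(\<Sum>l\<in>UNIV. \<alpha> $ l) = 1"
    and psd: "pos_semidef J"
    and model: "\<And>N. curie_weiss J (n N) (P N) (X N)"
    and high_temp: "high_temperature \<alpha> J"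
  shows "converges_weakly
           (\<lambda>N. distr (P N) borel (\<lambda>w. \<chi> l. group_sum (n N) (X N) l w / real (n N l)))
           (return borel 0)"
proof (rule converges_weakly_return)
  fix N
  interpret curie_weiss J "n N" "P N" "X N" by (rule model)
  show "prob_space (P N)" by unfold_locales
  have [measurable]: "(\<lambda>w. X N l i w) \<in> borel_measurable (P N)" if "i \<in> {1..n N l}" for l i
    using spin[OF that] by (rule measurable_compose) (simp add: measurable_count_space_eq1)
  show "(\<lambda>w. \<chi> l. group_sum (n N) (X N) l w / real (n N l)) \<in> borel_measurable (P N)"
    unfolding group_sum_def
    by (rule borel_measurable_euclidean_space[THEN iffD2])
      (auto simp: Basis_vec_def inner_axis intro!: borel_measurable_divide borel_measurable_sum)
next
  fix e :: real and k :: 'm assume e: "0 < e"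
  \<comment> \<open>For small \<open>N\<close> a group may be empty, and its mean is then
    \<open>0 / 0 = 0\<close>; the limit sees only large \<open>N\<close>.\<close>
  have pos: "\<forall>\<^sub>F N in sequentially. \<forall>l. 0 < n N l"
    by (intro eventually_all_finite eventually_compose_filterlim[OF eventually_gt_at_top sizes_at_top])
  have posN: "\<forall>\<^sub>F N in sequentially. 0 < N"
    by (rule eventually_gt_at_top)
  have "\<forall>\<^sub>F N in sequentially. \<forall>l. 0 < real (n N l) / real N"
    using pos posN by eventually_elim auto
  moreover have "\<forall>\<^sub>F N in sequentially. (\<Sum>l\<in>UNIV. real (n N l) / real N) = 1"
    using posN by eventually_elim (simp add: sizes_sum flip: sum_divide_distrib of_nat_sum)
  ultimately obtain d where d: "0 < d" "d \<le> 1" and form: "\<forall>\<^sub>F N in sequentially.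
      \<forall>v. v \<bullet> (J *v v) \<le> (1 - d) * (\<Sum>l\<in>UNIV. (v $ l)\<^sup>2 / (real (n N l) / real N))"
    using high_temperature_form_le[OF high_temp proportions] by blast
  let ?p = "\<lambda>N. measure (P N) {w \<in> space (P N). e \<le> \<bar>group_sum (n N) (X N) k w / n N k\<bar>}"
  have "?p \<longlonglongrightarrow> 0"
  proof (rule tendsto_sandwich[OF _ _ tendsto_const])
    show "\<forall>\<^sub>F N in sequentially. ?p N \<le> exp (- (d * e\<^sup>2 / 4 * n N k)) / sqrt (d / 2) ^ CARD('m)"
      using pos posN form
    proof eventually_elim
      case (elim N)
      interpret curie_weiss J "n N" "P N" "X N" by (rule model)
      show ?case
      proof (rule group_mean_tail[OF psd _ d e])
        fix v
        \<comment> \<open>Dividing by proportions instead of sizes contributes a factor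
          \<open>N\<close>, which cancels the division by the total number of spins.\<close>
        have "(\<Sum>l\<in>UNIV. (v $ l)\<^sup>2 / (real (n N l) / real N)) = (\<Sum>l\<in>UNIV. (v $ l)\<^sup>2 / n N l) * N"
          by (simp add: sum_distrib_right)
        then show "v \<bullet> (J *v v) / real (\<Sum>l\<in>UNIV. n N l) \<le> (1 - d) * (\<Sum>l\<in>UNIV. (v $ l)\<^sup>2 / n N l)"
          using elim(2) spec[OF elim(3), of v]
          by (simp only: sizes_sum) (simp add: pos_divide_le_eq mult.assoc)
      qed (use elim in auto)
    qed
    have "filterlim (\<lambda>N. real (n N k)) at_top sequentially"
      by (rule filterlim_compose[OF filterlim_real_sequentially sizes_at_top])
    then have "filterlim (\<lambda>N. d * e\<^sup>2 / 4 * real (n N k)) at_top sequentially"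
      using d e by (intro filterlim_tendsto_pos_mult_at_top[OF tendsto_const]) auto
    then have "(\<lambda>N. exp (- (d * e\<^sup>2 / 4 * n N k))) \<longlonglongrightarrow> 0"
      by (intro filterlim_compose[OF exp_at_bot] filterlim_compose[OF filterlim_uminus_at_bot_at_top])
    then show "(\<lambda>N. exp (- (d * e\<^sup>2 / 4 * n N k)) / sqrt (d / 2) ^ CARD('m)) \<longlonglongrightarrow> 0"
      by (rule tendsto_divide_zero)
  qed auto
  then show "(\<lambda>N. measure (P N) {w \<in> space (P N).
      e \<le> \<bar>(\<chi> l. group_sum (n N) (X N) l w / real (n N l)) $ k - 0 $ k\<bar>}) \<longlonglongrightarrow> 0"
    by simp
qed

end
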